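(* For any connected graph $G$ of order $n\geq 2$, $$\gamma_t(M(G\circ K_1))=n+\gamma(M(G)).$$
   Context: All graphs are finite and simple. The corona $G\circ K_1$ is the graph of order $2|V(G)|$ obtained from $G$ by adding, for each vertex $v$ of $G$, a new vertex adjacent only to $v$ (a pendant edge at each vertex). A dominating set of a graph $H$ is a set $S\subseteq V(H)$ such that every vertex of $H$ is in $S$ or has a neighbor in $S$; $\gamma(H)$ is the minimum cardinality of a dominating set. For a graph $H$ with no isolated vertices, a total dominating set of $H$ is a set $S\subseteq V(H)$ such that every vertex of $H$ has at least one neighbor in $S$; $\gamma_t(H)$ is the minimum cardinality of a total dominating set. The middle graph $M(G)$ of a graph $G$ has vertex set $V(G)\cup E(G)$ (disjoint union), and two of its vertices $x,y$ are adjacent exactly when either $x,y\in E(G)$ are edges of $G$ sharing a common endpoint, or $x\in V(G)$, $y\in E(G)$ and $x$ is an endpoint of $y$ (no two elements of $V(G)$ are adjacent in $M(G)$). *)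

theory Defs
  imports "Graph_Theory.Digraph_Component"
begin

text \<open>
  A finite simple graph is a \<^locale>\<open>pair_graph\<close>: a finite vertex set together with a finite
  symmetric irreflexive relation on it. Each undirected edge \<open>{u, v}\<close> is thus represented by the
  two arcs \<open>(u, v)\<close> and \<open>(v, u)\<close>; \<open>uedges\<close> recovers the undirected edges, each counted once.
\<close>

definition uedges :: "'a pair_pre_digraph \<Rightarrow> 'a set set" where
  "uedges G = (\<lambda>(u, v). {u, v}) ` parcs G"

text \<open>
  In the corona, \<open>Inl v\<close> is the copy of the vertex \<open>v\<close> of \<open>G\<close> and \<open>Inr v\<close> is the new vertex
  attached to it.
\<close>

definition corona_K1 :: "'a pair_pre_digraph \<Rightarrow> ('a + 'a) pair_pre_digraph" where
  "corona_K1 G = \<lparr>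
     pverts = pverts G <+> pverts G,
     parcs = {(Inl u, Inl v) | u v. (u, v) \<in> parcs G}
           \<union> {(Inl v, Inr v) | v. v \<in> pverts G}
           \<union> {(Inr v, Inl v) | v. v \<in> pverts G} \<rparr>"

definition middle_graph :: "'a pair_pre_digraph \<Rightarrow> ('a + 'a set) pair_pre_digraph" where
  "middle_graph G = \<lparr>
     pverts = pverts G <+> uedges G,
     parcs = {(Inr e, Inr f) | e f. e \<in> uedges G \<and> f \<in> uedges G \<and> e \<noteq> f \<and> e \<inter> f \<noteq> {}}
           \<union> {(Inl v, Inr e) | v e. v \<in> pverts G \<and> e \<in> uedges G \<and> v \<in> e}
           \<union> {(Inr e, Inl v) | v e. v \<in> pverts G \<and> e \<in> uedges G \<and> v \<in> e} \<rparr>"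

definition dominating_set :: "'a pair_pre_digraph \<Rightarrow> 'a set \<Rightarrow> bool" where
  "dominating_set H S \<longleftrightarrow>
     S \<subseteq> pverts H \<and> (\<forall>v \<in> pverts H. v \<in> S \<or> (\<exists>u \<in> S. (v, u) \<in> parcs H))"

definition total_dominating_set :: "'a pair_pre_digraph \<Rightarrow> 'a set \<Rightarrow> bool" where
  "total_dominating_set H S \<longleftrightarrow>
     S \<subseteq> pverts H \<and> (\<forall>v \<in> pverts H. \<exists>u \<in> S. (v, u) \<in> parcs H)"

definition domination_number :: "'a pair_pre_digraph \<Rightarrow> nat" where
  "domination_number H = Min {card S | S. dominating_set H S}"

text \<open>
  The total domination number is meaningful only for finite graphs without isolated vertices:
  otherwise the minimum is taken over the empty set and has no specified value. The lemmas at
  the end of this theory show that it is meaningful for the middle graph of a corona.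
\<close>

definition total_domination_number :: "'a pair_pre_digraph \<Rightarrow> nat" where
  "total_domination_number H = Min {card S | S. total_dominating_set H S}"

lemma pair_graphI':
  assumes "finite (pverts G)"
    and "\<And>u v. (u, v) \<in> parcs G \<Longrightarrow> u \<in> pverts G \<and> v \<in> pverts G \<and> u \<noteq> v \<and> (v, u) \<in> parcs G"
  shows "pair_graph G"
proof -
  have "parcs G \<subseteq> pverts G \<times> pverts G" using assms(2) by auto
  then have "finite (parcs G)" using assms(1) finite_subset by blast
  then show ?thesis
    using assms by unfold_locales (auto simp: symmetric_def intro!: symI)
qed

lemma finite_uedges: "pair_graph G \<Longrightarrow> finite (uedges G)"
  by (simp add: uedges_def pair_graph_def pair_digraph_def pair_fin_digraph.pair_finite_arcs)

lemma pair_graph_corona_K1: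
  assumes "pair_graph G"
  shows "pair_graph (corona_K1 G)"
proof -
  interpret pair_graph G by fact
  show ?thesis
    by (rule pair_graphI')
       (auto simp: corona_K1_def pair_finite_verts arcs_symmetric
             dest: arc_fst_in_verts arc_snd_in_verts pair_no_loops)
qed

lemma card_pverts_corona_K1:
  "pair_graph G \<Longrightarrow> card (pverts (corona_K1 G)) = 2 * card (pverts G)"
  by (simp add: corona_K1_def card_Plus pair_graph_def pair_digraph_def
      pair_fin_digraph.pair_finite_verts)

lemma pair_graph_middle_graph:
  assumes "pair_graph G"
  shows "pair_graph (middle_graph G)"
proof -
  interpret pair_graph G by fact
  show ?thesis
    by (rule pair_graphI')
       (auto simp: middle_graph_def pair_finite_verts finite_uedges[OF assms])
qed

lemma domination_number_attained:
  assumes "pair_graph H"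
  shows "finite {card S | S. dominating_set H S}" "{card S | S. dominating_set H S} \<noteq> {}"
proof -
  interpret pair_graph H by fact
  have "{card S | S. dominating_set H S} \<subseteq> card ` Pow (pverts H)"
    by (auto simp: dominating_set_def)
  then show "finite {card S | S. dominating_set H S}"
    using pair_finite_verts finite_subset by blast
  have "dominating_set H (pverts H)" by (auto simp: dominating_set_def)
  then show "{card S | S. dominating_set H S} \<noteq> {}" by blast
qed

lemma total_domination_number_attained:
  assumes "pair_graph H" and "\<And>v. v \<in> pverts H \<Longrightarrow> \<exists>u. (v, u) \<in> parcs H"
  shows "finite {card S | S. total_dominating_set H S}"
    "{card S | S. total_dominating_set H S} \<noteq> {}"
proof -
  interpret pair_graph H by fact
  have "{card S | S. total_dominating_set H S} \<subseteq> card ` Pow (pverts H)"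
    by (auto simp: total_dominating_set_def)
  then show "finite {card S | S. total_dominating_set H S}"
    using pair_finite_verts finite_subset by blast
  have "total_dominating_set H (pverts H)"
    using assms(2) by (fastforce simp: total_dominating_set_def dest: arc_snd_in_verts)
  then show "{card S | S. total_dominating_set H S} \<noteq> {}" by blast
qed

lemma middle_graph_corona_K1_no_isolated:
  assumes G: "pair_graph G" and v: "v \<in> pverts (middle_graph (corona_K1 G))"
  shows "\<exists>u. (v, u) \<in> parcs (middle_graph (corona_K1 G))"
proof -
  let ?C = "corona_K1 G"
  interpret C: pair_graph ?C using G by (rule pair_graph_corona_K1)
  show ?thesis
  proof (cases v)
    case (Inl x)
    with v have x: "x \<in> pverts ?C" by (auto simp: middle_graph_def)
    then obtain y where "(x, y) \<in> parcs ?C" by (auto simp: corona_K1_def)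
    then have "{x, y} \<in> uedges ?C" by (force simp: uedges_def)
    with x Inl show ?thesis by (auto simp: middle_graph_def)
  next
    case (Inr e)
    with v have e: "e \<in> uedges ?C" by (auto simp: middle_graph_def)
    then obtain x y where "(x, y) \<in> parcs ?C" "e = {x, y}" by (auto simp: uedges_def)
    then have "x \<in> pverts ?C" "x \<in> e" using C.arc_fst_in_verts by fastforce+
    with e Inr show ?thesis by (auto simp: middle_graph_def)
  qed
qed

end

theory Submission
  imports Defs
begin

text \<open>
  The leaf at \<open>v\<close> has the pendant edge at \<open>v\<close> as its only neighbour in the middle graph of the
  corona, so every total dominating set there contains all \<open>n\<close> pendant edges. These already
  totally dominate everything except themselves, and dominating the pendant edge at each \<open>v\<close>
  takes, up to collapsing each leaf onto its support vertex, either \<open>v\<close> or an edge of \<open>G\<close> at \<open>v\<close>.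
  This is exactly the condition for dominating the middle graph of \<open>G\<close>: once all vertices are
  dominated, so are the edges.
\<close>

section \<open>Edges of the corona and vertices of its middle graph\<close>

definition pendant_edge :: "'a \<Rightarrow> ('a + 'a) set" where
  "pendant_edge v = {Inl v, Inr v}"

lemma inj_pendant_edge: "inj pendant_edge"
  by (auto simp: inj_def pendant_edge_def doubleton_eq_iff)

lemma uedges_corona_K1:
  "uedges (corona_K1 G) = image Inl ` uedges G \<union> pendant_edge ` pverts G"
proof -
  have "parcs (corona_K1 G) = map_prod Inl Inl ` parcs G
      \<union> (\<lambda>v. (Inl v, Inr v)) ` pverts G \<union> (\<lambda>v. (Inr v, Inl v)) ` pverts G"
    by (auto simp: corona_K1_def)
  moreover have "{Inr v, Inl v} = pendant_edge v" for v :: 'a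
    by (auto simp: pendant_edge_def)
  ultimately show ?thesis
    by (simp add: uedges_def image_Un image_image case_prod_unfold pendant_edge_def[symmetric] Un_assoc)
qed

lemma pverts_corona_K1: "pverts (corona_K1 G) = pverts G <+> pverts G"
  by (simp add: corona_K1_def)

lemma pverts_middle_corona:
  "pverts (middle_graph (corona_K1 G)) =
    (pverts G <+> pverts G) <+> (image Inl ` uedges G \<union> pendant_edge ` pverts G)"
  by (simp add: middle_graph_def uedges_corona_K1 pverts_corona_K1)

text \<open>Membership in \<open>S\<close> is kept as a premise so that only elements present in
  \<open>S\<close> have to land in the target. This matters for the collapse of the corona onto
  \<open>G\<close>: a pendant edge would go to a singleton, which is no edge, but the pendant edges
  have been removed from \<open>S\<close> by then.\<close>

lemma image_map_sum_Plus_subset: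
  assumes "S \<subseteq> A <+> B"
    and "\<And>a. a \<in> A \<Longrightarrow> Inl a \<in> S \<Longrightarrow> f a \<in> C"
    and "\<And>b. b \<in> B \<Longrightarrow> Inr b \<in> S \<Longrightarrow> g b \<in> D"
  shows "map_sum f g ` S \<subseteq> C <+> D"
proof clarify
  fix x assume x: "x \<in> S"
  with assms show "map_sum f g x \<in> C <+> D" by (cases x) auto
qed

text \<open>The leaf \<open>Inr v\<close> tells them apart. Adjacency of two edges in a middle graph
  demands that they differ, so every adjacency between a pendant edge and an edge of
  \<open>G\<close> rests on this.\<close>

lemma pendant_edge_neq_image_Inl: "pendant_edge v \<noteq> Inl ` e"
  by (auto simp: pendant_edge_def)

lemma (in pair_graph) uedgesE:
  assumes "e \<in> uedges G"
  obtains u v where "e = {u, v}" "u \<in> pverts G" "v \<in> pverts G"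
proof -
  from assms obtain u v where "(u, v) \<in> parcs G" "e = {u, v}" by (auto simp: uedges_def)
  then show ?thesis using that[of u v] arc_fst_in_verts arc_snd_in_verts by fastforce
qed

section \<open>Minimality and attainment of the two domination numbers\<close>

lemma domination_number_le:
  "pair_graph H \<Longrightarrow> dominating_set H S \<Longrightarrow> domination_number H \<le> card S"
  unfolding domination_number_def by (rule Min_le) (auto intro: domination_number_attained)

lemma obtain_domination_number:
  assumes "pair_graph H"
  obtains S where "dominating_set H S" "card S = domination_number H"
  using Min_in[OF domination_number_attained[OF assms]]
  unfolding domination_number_def by auto

context
  fixes H :: "'a pair_pre_digraph"
  assumes H: "pair_graph H" and no_isolated: "\<And>v. v \<in> pverts H \<Longrightarrow> \<exists>u. (v, u) \<in> parcs H"
begin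

lemma total_domination_number_le:
  "total_dominating_set H S \<Longrightarrow> total_domination_number H \<le> card S"
  unfolding total_domination_number_def
  by (rule Min_le) (auto intro: total_domination_number_attained[OF H no_isolated])

lemma obtain_total_domination_number:
  obtains S where "total_dominating_set H S" "card S = total_domination_number H"
  using Min_in[OF total_domination_number_attained[OF H no_isolated]]
  unfolding total_domination_number_def by auto

end

section \<open>Passing between dominating sets of the two middle graphs\<close>

text \<open>Take an endpoint \<open>v\<close> of an edge \<open>e\<close>. If \<open>v\<close>
  itself is chosen, it is adjacent to \<open>e\<close>; if a chosen edge \<open>f\<close> contains
  \<open>v\<close>, then \<open>f\<close> is \<open>e\<close> or meets \<open>e\<close> in
  \<open>v\<close>. Either way \<open>e\<close> is dominated.\<close>

lemma dominating_set_middle_graph_iff: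
  assumes "pair_graph G"
  shows "dominating_set (middle_graph G) D \<longleftrightarrow>
    D \<subseteq> pverts G <+> uedges G \<and>
    (\<forall>v\<in>pverts G. Inl v \<in> D \<or> (\<exists>e\<in>uedges G. v \<in> e \<and> Inr e \<in> D))" (is "_ \<longleftrightarrow> ?R")
proof
  assume "dominating_set (middle_graph G) D"
  then have sub: "D \<subseteq> pverts G <+> uedges G"
    and dom: "\<And>v. v \<in> pverts G \<Longrightarrow>
      Inl v \<in> D \<or> (\<exists>u\<in>D. (Inl v, u) \<in> parcs (middle_graph G))"
    by (auto simp: dominating_set_def middle_graph_def)
  have "Inl v \<in> D \<or> (\<exists>e\<in>uedges G. v \<in> e \<and> Inr e \<in> D)" if "v \<in> pverts G" for v
    using dom[OF that] by (auto simp: middle_graph_def)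
  with sub show ?R by blast
next
  interpret pair_graph G by fact
  assume R: ?R
  have "Inr e \<in> D \<or> (\<exists>u\<in>D. (Inr e, u) \<in> parcs (middle_graph G))" if e: "e \<in> uedges G" for e
  proof -
    obtain v where v: "v \<in> e" "v \<in> pverts G" using e by (auto elim: uedgesE)
    with R consider "Inl v \<in> D" | f where "f \<in> uedges G" "v \<in> f" "Inr f \<in> D" by blast
    then show ?thesis
    proof cases
      case 1
      with v e show ?thesis by (auto simp: middle_graph_def)
    next
      case 2
      show ?thesis
      proof (cases "e = f")
        case False
        with 2 v e have "(Inr e, Inr f) \<in> parcs (middle_graph G)"
          by (auto simp: middle_graph_def)
        with 2 show ?thesis by blast
      qed (use 2 in simp)
    qed
  qed
  moreover have "Inl v \<in> D \<or> (\<exists>u\<in>D. (Inl v, u) \<in> parcs (middle_graph G))"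
    if "v \<in> pverts G" for v
    using R that by (fastforce simp: middle_graph_def)
  moreover have "pverts (middle_graph G) = pverts G <+> uedges G"
    by (simp add: middle_graph_def)
  ultimately show "dominating_set (middle_graph G) D"
    using R unfolding dominating_set_def by (metis PlusE)
qed

text \<open>The two summands share the work: pendant edges serve the vertices, the leaves and the
  copies of edges of \<open>G\<close>, while the copy of \<open>D\<close> serves the pendant
  edges.\<close>

lemma total_dominating_set_middle_corona:
  fixes G :: "'a pair_pre_digraph"
  assumes G: "pair_graph G" and D: "dominating_set (middle_graph G) D"
  shows "total_dominating_set (middle_graph (corona_K1 G))
    (Inr ` pendant_edge ` pverts G \<union> map_sum Inl (image Inl) ` D)"
proof -
  interpret pair_graph G by fact
  let ?M = "middle_graph (corona_K1 G)"
  let ?S = "Inr ` pendant_edge ` pverts G \<union> map_sum Inl (image Inl) ` D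
    :: (('a + 'a) + ('a + 'a) set) set"
  have "D \<subseteq> pverts G <+> uedges G"
    using D by (simp add: dominating_set_middle_graph_iff[OF G])
  then have "map_sum Inl (image Inl) ` D \<subseteq> pverts ?M"
    unfolding pverts_middle_corona by (rule image_map_sum_Plus_subset) auto
  then have sub: "?S \<subseteq> pverts ?M" by (auto simp: pverts_middle_corona)
  have "\<exists>u\<in>?S. (x, u) \<in> parcs ?M" if "x \<in> pverts ?M" for x
  proof -
    from that consider v where "v \<in> pverts G" "x = Inl (Inl v) \<or> x = Inl (Inr v)"
      | e where "e \<in> uedges G" "x = Inr (Inl ` e)"
      | v where "v \<in> pverts G" "x = Inr (pendant_edge v)"
      by (auto simp: pverts_middle_corona)
    then show ?thesis
    proof cases
      case 1
      then have "(x, Inr (pendant_edge v)) \<in> parcs ?M"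
        by (auto simp: middle_graph_def uedges_corona_K1 pendant_edge_def pverts_corona_K1)
      with 1 show ?thesis by blast
    next
      case 2
      \<comment> \<open>Any endpoint of \<open>e\<close> will do: its pendant edge meets the copy of
        \<open>e\<close> there.\<close>
      then obtain v where v: "v \<in> e" "v \<in> pverts G" by (auto elim: uedgesE)
      then have "Inl v \<in> Inl ` e \<inter> pendant_edge v" by (auto simp: pendant_edge_def)
      with 2 v have "(x, Inr (pendant_edge v)) \<in> parcs ?M"
        using pendant_edge_neq_image_Inl[of v e]
        by (auto simp: middle_graph_def uedges_corona_K1)
      with v show ?thesis by blast
    next
      case 3
      with D consider "Inl v \<in> D" | e where "e \<in> uedges G" "v \<in> e" "Inr e \<in> D"
        by (auto simp: dominating_set_middle_graph_iff[OF G])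
      then show ?thesis
      proof cases
        case 1
        with 3 have "(x, Inl (Inl v)) \<in> parcs ?M"
          by (auto simp: middle_graph_def uedges_corona_K1 pendant_edge_def pverts_corona_K1)
        moreover have "Inl (Inl v) \<in> ?S"
          by (rule UnI2) (metis 1 imageI map_sum.simps(1))
        ultimately show ?thesis by blast
      next
        case 2
        then have "Inl v \<in> pendant_edge v \<inter> Inl ` e" by (auto simp: pendant_edge_def)
        with 2 3 have "(x, Inr (Inl ` e)) \<in> parcs ?M"
          using pendant_edge_neq_image_Inl[of v e]
          by (auto simp: middle_graph_def uedges_corona_K1)
        moreover have "Inr (Inl ` e) \<in> ?S"
          by (rule UnI2) (metis 2(3) imageI map_sum.simps(2))
        ultimately show ?thesis by blast
      qed
    qed
  qed
  with sub show ?thesis by (simp add: total_dominating_set_def)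
qed

lemma pendant_edges_subset_total_dominating_set:
  assumes "total_dominating_set (middle_graph (corona_K1 G)) S"
  shows "Inr ` pendant_edge ` pverts G \<subseteq> S"
proof clarify
  fix v assume v: "v \<in> pverts G"
  then have "Inl (Inr v) \<in> pverts (middle_graph (corona_K1 G))"
    by (auto simp: pverts_middle_corona)
  with assms obtain u where "u \<in> S" "(Inl (Inr v), u) \<in> parcs (middle_graph (corona_K1 G))"
    by (auto simp: total_dominating_set_def)
  moreover from this(2) have "u = Inr (pendant_edge v)"
    by (auto simp: middle_graph_def uedges_corona_K1 pendant_edge_def)
  ultimately show "Inr (pendant_edge v) \<in> S" by simp
qed

text \<open>The map \<open>c\<close> identifies each leaf with its support vertex and turns the copy
  of an edge of \<open>G\<close> back into that edge. Whatever dominates the pendant edge at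
  \<open>v\<close> in \<open>S\<close> is thereby sent to \<open>v\<close> or to an edge at
  \<open>v\<close>.\<close>

lemma dominating_set_middle_of_corona:
  assumes G: "pair_graph G" and S: "total_dominating_set (middle_graph (corona_K1 G)) S"
  defines "c \<equiv> case_sum id id"
  shows "dominating_set (middle_graph G)
    (map_sum c (image c) ` (S - Inr ` pendant_edge ` pverts G))"
proof -
  let ?M = "middle_graph (corona_K1 G)"
  let ?P = "Inr ` pendant_edge ` pverts G"
  let ?D = "map_sum c (image c) ` (S - ?P)"
  have c: "c ` Inl ` e = e" for e by (simp add: c_def image_image)
  have "S \<subseteq> pverts ?M" using S by (simp add: total_dominating_set_def)
  then have "S - ?P \<subseteq>
      (pverts G <+> pverts G) <+> (image Inl ` uedges G \<union> pendant_edge ` pverts G)"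
    by (auto simp: pverts_middle_corona)
  then have "?D \<subseteq> pverts G <+> uedges G"
    by (rule image_map_sum_Plus_subset) (auto simp: c, auto simp: c_def)
  moreover have "Inl v \<in> ?D \<or> (\<exists>e\<in>uedges G. v \<in> e \<and> Inr e \<in> ?D)" if v: "v \<in> pverts G" for v
  proof -
    from v have "Inr (pendant_edge v) \<in> pverts ?M"
      by (auto simp: middle_graph_def uedges_corona_K1)
    with S obtain u where u: "u \<in> S" "(Inr (pendant_edge v), u) \<in> parcs ?M"
      by (auto simp: total_dominating_set_def)
    \<comment> \<open>Pendant edges at distinct vertices are disjoint, so \<open>u\<close> is not a
      pendant edge and survives the removal of \<open>?P\<close>.\<close>
    then consider "u = Inl (Inl v) \<or> u = Inl (Inr v)"
      | e where "e \<in> uedges G" "v \<in> e" "u = Inr (Inl ` e)"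
      by (auto simp: middle_graph_def uedges_corona_K1 pendant_edge_def)
    then show ?thesis
    proof cases
      case 1
      with u have "u \<in> S - ?P" "map_sum c (image c) u = Inl v" by (auto simp: c_def)
      then have "Inl v \<in> ?D" by (metis imageI)
      then show ?thesis by blast
    next
      case 2
      with u have "u \<in> S - ?P" "map_sum c (image c) u = Inr e"
        by (auto simp: c pendant_edge_neq_image_Inl[symmetric])
      then have "Inr e \<in> ?D" by (metis imageI)
      with 2 show ?thesis by blast
    qed
  qed
  ultimately show ?thesis by (simp add: dominating_set_middle_graph_iff[OF G])
qed

theorem theorem4p3:
  fixes G :: "'a pair_pre_digraph" and n :: nat
  assumes "pair_graph G"
    and "connected (with_proj G)"
    and "card (pverts G) = n"
    and "n \<ge> 2"
  shows "total_domination_number (middle_graph (corona_K1 G))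
         = n + domination_number (middle_graph G)"
proof (rule antisym)
  let ?M = "middle_graph (corona_K1 G)"
  let ?P = "Inr ` pendant_edge ` pverts G :: (('a + 'a) + ('a + 'a) set) set"
  note G = assms(1)
  interpret pair_graph G by fact
  note MG = pair_graph_middle_graph[OF G]
  note M = pair_graph_middle_graph[OF pair_graph_corona_K1[OF G]]
    middle_graph_corona_K1_no_isolated[OF G]
  interpret MG: pair_graph "middle_graph G" by (rule MG)
  interpret M: pair_graph ?M by (rule M(1))
  have P: "finite ?P" "card ?P = n"
    using pair_finite_verts assms(3)
    by (auto simp: card_image inj_on_subset[OF inj_pendant_edge])
  show "total_domination_number ?M \<le> n + domination_number (middle_graph G)"
  proof -
    obtain D where D: "dominating_set (middle_graph G) D"
      "card D = domination_number (middle_graph G)"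
      by (rule obtain_domination_number[OF MG])
    have "finite D"
      using D(1) MG.pair_finite_verts by (auto simp: dominating_set_def finite_subset)
    have "total_domination_number ?M \<le> card (?P \<union> map_sum Inl (image Inl) ` D)"
      by (intro total_domination_number_le[OF M] total_dominating_set_middle_corona G D)
    also have "\<dots> \<le> card ?P + card D"
      using card_Un_le card_image_le[OF \<open>finite D\<close>] by (meson add_left_mono order_trans)
    finally show ?thesis using P D by simp
  qed
  show "n + domination_number (middle_graph G) \<le> total_domination_number ?M"
  proof -
    obtain S where S: "total_dominating_set ?M S" "card S = total_domination_number ?M"
      by (rule obtain_total_domination_number[OF M])
    have "finite S"
      using S(1) M.pair_finite_verts by (auto simp: total_dominating_set_def finite_subset)
    have sub: "?P \<subseteq> S" by (rule pendant_edges_subset_total_dominating_set[OF S(1)])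
    \<comment> \<open>The collapse may merge a vertex with its leaf, which can only lower the
      cardinality.\<close>
    have "domination_number (middle_graph G) \<le> card (S - ?P)"
      using domination_number_le[OF MG dominating_set_middle_of_corona[OF G S(1)]]
        card_image_le \<open>finite S\<close> by (meson finite_Diff order_trans)
    also have "\<dots> = card S - n" using card_Diff_subset[OF P(1) sub] P(2) by simp
    \<comment> \<open>Subtraction on \<open>nat\<close> is truncated; \<open>card_mono\<close>
      supplies \<open>n \<le> card S\<close>, which allows \<open>n\<close> to be moved to the other
      side.\<close>
    finally show ?thesis using S(2) card_mono[OF \<open>finite S\<close> sub] P(2) by simp
  qed
qed

end
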